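(* Let $\mathbb{F}$ be $\mathbb{R}$ or $\mathbb{C}$, let $(\mathfrak{d},\Omega)$ be an indecomposable symmetric self-dual Lie algebra over $\mathbb{F}$ with Killing form $\kappa$, and let $t\in\mathbb{F}$. Put $g_t=\Omega-t\kappa$ and let $\mathfrak{d}^\perp=\{v\in\mathfrak{d} : g_t(v,w)=0 \text{ for all } w\in\mathfrak{d}\}$ be the radical of $g_t$. Then $\mathfrak{d}^\perp=0$ unless $\mathfrak{d}$ is simple and $\Omega=t\kappa$, in which case $g_t=0$ and $\mathfrak{d}^\perp=\mathfrak{d}$.
   Context: A symmetric self-dual Lie algebra is a pair $(\mathfrak{d},\Omega)$ where $\mathfrak{d}$ is a finite-dimensional Lie algebra and $\Omega$ is a nondegenerate symmetric ad-invariant bilinear form on $\mathfrak{d}$, i.e. $\Omega([x,y],z)=\Omega(x,[y,z])$ for all $x,y,z$. It is decomposable if it is isometrically isomorphic to an orthogonal direct product $(\mathfrak{g}_1\times\mathfrak{g}_2,\Omega_1\oplus\Omega_2)$ of two nonzero symmetric self-dual Lie algebras, and indecomposable if it is nonzero and not decomposable. Here $\perp$ refers to the form $g_t$, not to $\Omega$. *)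

theory Defs
  imports Complex_Main "HOL-Analysis.Product_Vector"
begin

text \<open>The fields that are the real or the complex numbers, up to field isomorphism.\<close>

class real_or_complex = field_char_0 +
  assumes real_or_complex:
    "(\<exists>h :: 'a \<Rightarrow> real. bij h \<and> (\<forall>a b. h (a + b) = h a + h b) \<and> (\<forall>a b. h (a * b) = h a * h b)) \<or>
     (\<exists>h :: 'a \<Rightarrow> complex. bij h \<and> (\<forall>a b. h (a + b) = h a + h b) \<and> (\<forall>a b. h (a * b) = h a * h b))"

instance real :: real_or_complex
  by standard (rule disjI1, rule exI[of _ id], simp)

instance complex :: real_or_complex
  by standard (rule disjI2, rule exI[of _ id], simp)

text \<open>Lie algebras are carried by finite-dimensional subspaces of an ambient vector space,
  so that all the functions below matter only on the carrier.\<close>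

locale lie_algebra = vector_space scale
  for scale :: "'k::field \<Rightarrow> 'v::ab_group_add \<Rightarrow> 'v" +
  fixes L :: "'v set" and br :: "'v \<Rightarrow> 'v \<Rightarrow> 'v"
  assumes subspace_carrier: "subspace L"
    and finite_dimensional: "\<exists>B. finite B \<and> span B = L"
    and br_closed: "x \<in> L \<Longrightarrow> y \<in> L \<Longrightarrow> br x y \<in> L"
    and br_add_left: "x \<in> L \<Longrightarrow> y \<in> L \<Longrightarrow> z \<in> L \<Longrightarrow> br (x + y) z = br x z + br y z"
    and br_add_right: "x \<in> L \<Longrightarrow> y \<in> L \<Longrightarrow> z \<in> L \<Longrightarrow> br x (y + z) = br x y + br x z"
    and br_scale_left: "x \<in> L \<Longrightarrow> y \<in> L \<Longrightarrow> br (scale c x) y = scale c (br x y)"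
    and br_scale_right: "x \<in> L \<Longrightarrow> y \<in> L \<Longrightarrow> br x (scale c y) = scale c (br x y)"
    and br_alternating: "x \<in> L \<Longrightarrow> br x x = 0"
    and jacobi: "x \<in> L \<Longrightarrow> y \<in> L \<Longrightarrow> z \<in> L \<Longrightarrow>
      br x (br y z) + br y (br z x) + br z (br x y) = 0"

text \<open>The trace of a linear endomorphism \<open>f\<close> of the finite-dimensional subspace \<open>V\<close>: the sum of
  the diagonal coefficients of \<open>f\<close> in some basis of \<open>V\<close>.\<close>

definition (in vector_space) trace_on :: "'b set \<Rightarrow> ('b \<Rightarrow> 'b) \<Rightarrow> 'a" where
  "trace_on V f =
    (let B = (SOME B. independent B \<and> span B = V) in \<Sum>b\<in>B. representation B (f b) b)"

context lie_algebra
begin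

definition killing :: "'v \<Rightarrow> 'v \<Rightarrow> 'k" where
  "killing x y = trace_on L (\<lambda>z. br x (br y z))"

definition lie_ideal :: "'v set \<Rightarrow> bool" where
  "lie_ideal I \<longleftrightarrow> subspace I \<and> I \<subseteq> L \<and> (\<forall>x\<in>L. \<forall>y\<in>I. br x y \<in> I)"

definition abelian :: bool where
  "abelian \<longleftrightarrow> (\<forall>x\<in>L. \<forall>y\<in>L. br x y = 0)"

definition simple :: bool where
  "simple \<longleftrightarrow> \<not> abelian \<and> (\<forall>I. lie_ideal I \<longrightarrow> I = {0} \<or> I = L)"

end

definition form_radical :: "'v set \<Rightarrow> ('v \<Rightarrow> 'v \<Rightarrow> 'k::zero) \<Rightarrow> 'v set" where
  "form_radical L g = {v\<in>L. \<forall>w\<in>L. g v w = 0}"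

locale self_dual_lie_algebra = lie_algebra scale L br
  for scale :: "'k::field \<Rightarrow> 'v::ab_group_add \<Rightarrow> 'v" and L and br +
  fixes \<Omega> :: "'v \<Rightarrow> 'v \<Rightarrow> 'k"
  assumes form_add: "x \<in> L \<Longrightarrow> y \<in> L \<Longrightarrow> z \<in> L \<Longrightarrow> \<Omega> (x + y) z = \<Omega> x z + \<Omega> y z"
    and form_scale: "x \<in> L \<Longrightarrow> y \<in> L \<Longrightarrow> \<Omega> (scale c x) y = c * \<Omega> x y"
    and form_sym: "x \<in> L \<Longrightarrow> y \<in> L \<Longrightarrow> \<Omega> x y = \<Omega> y x"
    and form_invariant: "x \<in> L \<Longrightarrow> y \<in> L \<Longrightarrow> z \<in> L \<Longrightarrow> \<Omega> (br x y) z = \<Omega> x (br y z)"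
    and form_nondegenerate: "form_radical L \<Omega> = {0}"

definition isometric_lie_iso ::
  "('k \<Rightarrow> 'v::plus \<Rightarrow> 'v) \<Rightarrow> 'v set \<Rightarrow> ('v \<Rightarrow> 'v \<Rightarrow> 'v) \<Rightarrow> ('v \<Rightarrow> 'v \<Rightarrow> 'k) \<Rightarrow>
   ('k \<Rightarrow> 'w::plus \<Rightarrow> 'w) \<Rightarrow> 'w set \<Rightarrow> ('w \<Rightarrow> 'w \<Rightarrow> 'w) \<Rightarrow> ('w \<Rightarrow> 'w \<Rightarrow> 'k) \<Rightarrow> ('v \<Rightarrow> 'w) \<Rightarrow> bool" where
  "isometric_lie_iso s L br \<Omega> s' L' br' \<Omega>' \<phi> \<longleftrightarrow>
     bij_betw \<phi> L L' \<and>
     (\<forall>x\<in>L. \<forall>y\<in>L. \<phi> (x + y) = \<phi> x + \<phi> y) \<and>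
     (\<forall>c. \<forall>x\<in>L. \<phi> (s c x) = s' c (\<phi> x)) \<and>
     (\<forall>x\<in>L. \<forall>y\<in>L. \<phi> (br x y) = br' (\<phi> x) (\<phi> y)) \<and>
     (\<forall>x\<in>L. \<forall>y\<in>L. \<Omega>' (\<phi> x) (\<phi> y) = \<Omega> x y)"

definition product_bracket ::
  "('v \<Rightarrow> 'v \<Rightarrow> 'v) \<Rightarrow> ('w \<Rightarrow> 'w \<Rightarrow> 'w) \<Rightarrow> 'v \<times> 'w \<Rightarrow> 'v \<times> 'w \<Rightarrow> 'v \<times> 'w" where
  "product_bracket br1 br2 p q = (br1 (fst p) (fst q), br2 (snd p) (snd q))"

definition orthogonal_sum_form ::
  "('v \<Rightarrow> 'v \<Rightarrow> 'k::plus) \<Rightarrow> ('w \<Rightarrow> 'w \<Rightarrow> 'k) \<Rightarrow> 'v \<times> 'w \<Rightarrow> 'v \<times> 'w \<Rightarrow> 'k" where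
  "orthogonal_sum_form \<Omega>1 \<Omega>2 p q = \<Omega>1 (fst p) (fst q) + \<Omega>2 (snd p) (snd q)"

text \<open>HOL cannot quantify over the types carrying the two factors. Letting them range over
  subspaces of the ambient space of \<open>L\<close>, with arbitrary brackets and forms of their own, loses
  nothing: factors in any other spaces can be transported to the preimages in \<open>L\<close> of
  \<open>L1 \<times> {0}\<close> and \<open>{0} \<times> L2\<close> under the isomorphism.\<close>

definition decomposable ::
  "('k::field \<Rightarrow> 'v::ab_group_add \<Rightarrow> 'v) \<Rightarrow> 'v set \<Rightarrow> ('v \<Rightarrow> 'v \<Rightarrow> 'v) \<Rightarrow> ('v \<Rightarrow> 'v \<Rightarrow> 'k) \<Rightarrow> bool" where
  "decomposable s L br \<Omega> \<longleftrightarrow>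
     (\<exists>L1 br1 \<Omega>1 L2 br2 \<Omega>2 \<phi>.
        self_dual_lie_algebra s L1 br1 \<Omega>1 \<and> L1 \<noteq> {0} \<and>
        self_dual_lie_algebra s L2 br2 \<Omega>2 \<and> L2 \<noteq> {0} \<and>
        isometric_lie_iso s L br \<Omega>
          (module_prod.scale s s) (L1 \<times> L2) (product_bracket br1 br2) (orthogonal_sum_form \<Omega>1 \<Omega>2) \<phi>)"

definition indecomposable ::
  "('k::field \<Rightarrow> 'v::ab_group_add \<Rightarrow> 'v) \<Rightarrow> 'v set \<Rightarrow> ('v \<Rightarrow> 'v \<Rightarrow> 'v) \<Rightarrow> ('v \<Rightarrow> 'v \<Rightarrow> 'k) \<Rightarrow> bool" where
  "indecomposable s L br \<Omega> \<longleftrightarrow> L \<noteq> {0} \<and> \<not> decomposable s L br \<Omega>"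

end

theory Submission
  imports Defs
begin

text \<open>If \<open>I\<close> is an ideal on which \<open>\<Omega>\<close> agrees with \<open>t \<kappa>\<close> against all of \<open>\<dd>\<close>, then
  \<open>A = I \<inter> I\<^sup>\<perp>\<close> (complement with respect to \<open>\<Omega>\<close>) is an abelian ideal by invariance. For \<open>a \<in> A\<close>
  the map \<open>ad a \<circ> ad x\<close> sends \<open>\<dd>\<close> into \<open>A\<close> and kills \<open>A\<close>, so \<open>\<kappa> a x = 0\<close>, hence \<open>\<Omega> a x = 0\<close> for
  all \<open>x\<close> and \<open>a = 0\<close>. Thus \<open>\<dd> = I \<oplus> I\<^sup>\<perp>\<close>, and indecomposability makes \<open>I\<close> trivial. Apply this
  first to the radical of \<open>g\<^sub>t\<close>; if that is all of \<open>\<dd>\<close>, it applies to every ideal, so \<open>\<dd>\<close> is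
  simple.\<close>

section \<open>Traces on finite-dimensional subspaces\<close>

text \<open>Linearity is required on the carrier \<open>V\<close> only, since nothing is assumed
  about a bracket outside the carrier of its Lie algebra.\<close>

definition (in vector_space) linear_endo :: "'b set \<Rightarrow> ('b \<Rightarrow> 'b) \<Rightarrow> bool" where
  "linear_endo V f \<longleftrightarrow> (\<forall>x\<in>V. f x \<in> V) \<and> (\<forall>x\<in>V. \<forall>y\<in>V. f (x + y) = f x + f y) \<and>
     (\<forall>c. \<forall>x\<in>V. f (c *s x) = c *s f x)"

context vector_space
begin

lemma linear_endo_mem: "linear_endo V f \<Longrightarrow> x \<in> V \<Longrightarrow> f x \<in> V"
  by (simp add: linear_endo_def)

lemma linear_endo_zero: "linear_endo V f \<Longrightarrow> x \<in> V \<Longrightarrow> f 0 = 0"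
  unfolding linear_endo_def by (metis scale_zero_left)

lemma linear_endo_sum:
  assumes "linear_endo V f" "subspace V" "finite B" "\<And>b. b \<in> B \<Longrightarrow> v b \<in> V"
  shows "f (\<Sum>b\<in>B. c b *s v b) = (\<Sum>b\<in>B. c b *s f (v b))"
  using assms(3,4)
proof (induction B rule: finite_induct)
  case empty
  show ?case using linear_endo_zero[OF assms(1) subspace_0[OF assms(2)]] by simp
next
  case (insert b B)
  have "(\<Sum>b\<in>B. c b *s v b) \<in> V" "c b *s v b \<in> V"
    using insert.prems assms(2) by (auto intro!: subspace_sum subspace_scale)
  then show ?case
    using insert assms(1) by (simp add: linear_endo_def)
qed

lemma subspace_finite_basis:
  assumes "subspace V" "V \<subseteq> span S" "finite S"
  obtains B where "finite B" "independent B" "span B = V"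
proof -
  obtain B where B: "B \<subseteq> V" "independent B" "V \<subseteq> span B"
    using basis_exists[of V] by metis
  have "finite B" using independent_span_bound[OF assms(3) B(2)] B(1) assms(2) by auto
  moreover have "span B = V" using B(1,3) span_minimal[OF B(1) assms(1)] by auto
  ultimately show thesis using that B(2) by blast
qed

text \<open>The basis chosen by \<open>SOME\<close> depends on \<open>V\<close> alone, so a single
  \<open>B\<close> computes the trace of every map. Traces of different maps can thus be compared
  without a change of basis.\<close>

lemma trace_on_basis:
  assumes "finite S" "span S = V"
  obtains B where "finite B" "independent B" "span B = V"
    "\<And>f. trace_on V f = (\<Sum>b\<in>B. representation B (f b) b)"
proof -
  define B where "B = (SOME B. independent B \<and> span B = V)"
  have "subspace V" using assms(2) subspace_span by blast
  then have "\<exists>B. independent B \<and> span B = V"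
    using assms subspace_finite_basis[of V S] by blast
  then have B: "independent B \<and> span B = V" unfolding B_def by (rule someI_ex)
  then have "finite B"
    using independent_span_bound[OF assms(1), of B] assms(2) span_superset by blast
  then show thesis
    using that[of B] B unfolding trace_on_def B_def[symmetric] Let_def by blast
qed

lemma trace_on_add:
  assumes "finite S" "span S = V" "linear_endo V f" "linear_endo V g"
  shows "trace_on V (\<lambda>x. f x + g x) = trace_on V f + trace_on V g"
proof -
  obtain B where B: "independent B" "span B = V"
    and tr: "\<And>f. trace_on V f = (\<Sum>b\<in>B. representation B (f b) b)"
    using trace_on_basis[OF assms(1,2)] by metis
  have "f b \<in> span B \<and> g b \<in> span B" if "b \<in> B" for b
    using that B(2) span_base assms(3,4) linear_endo_mem by metis
  then show ?thesis
    unfolding tr sum.distrib[symmetric]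
    by (intro sum.cong) (simp_all add: representation_add[OF B(1)])
qed

lemma trace_on_scale:
  assumes "finite S" "span S = V" "linear_endo V f"
  shows "trace_on V (\<lambda>x. c *s f x) = c * trace_on V f"
proof -
  obtain B where B: "independent B" "span B = V"
    and tr: "\<And>f. trace_on V f = (\<Sum>b\<in>B. representation B (f b) b)"
    using trace_on_basis[OF assms(1,2)] by metis
  have "f b \<in> span B" if "b \<in> B" for b
    using that B(2) span_base assms(3) linear_endo_mem by metis
  then show ?thesis
    unfolding tr sum_distrib_left
    by (intro sum.cong) (simp_all add: representation_scale[OF B(1)])
qed

lemma trace_on_cong:
  assumes "finite S" "span S = V" "\<And>x. x \<in> V \<Longrightarrow> f x = g x"
  shows "trace_on V f = trace_on V g"
proof -
  obtain B where B: "independent B" "span B = V"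
    and tr: "\<And>f. trace_on V f = (\<Sum>b\<in>B. representation B (f b) b)"
    using trace_on_basis[OF assms(1,2)] by metis
  show ?thesis
    unfolding tr using B(2) span_base assms(3) by (intro sum.cong) auto
qed

text \<open>Both traces are double sums of products of matrix entries in one basis, and the two sums
  differ only in the order of summation.\<close>

lemma trace_on_commute:
  assumes "finite S" "span S = V" "linear_endo V f" "linear_endo V g"
  shows "trace_on V (\<lambda>x. f (g x)) = trace_on V (\<lambda>x. g (f x))"
proof -
  obtain B where B: "finite B" "independent B" "span B = V"
    and tr: "\<And>f. trace_on V f = (\<Sum>b\<in>B. representation B (f b) b)"
    using trace_on_basis[OF assms(1,2)] by metis
  have BV: "b \<in> V" if "b \<in> B" for b using that B(3) span_base by blast
  have V: "subspace V" using B(3) subspace_span by blast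
  \<comment> \<open>The diagonal of a matrix product, stated for general \<open>h\<close> and
    \<open>k\<close> so that it serves both orders of composition.\<close>
  have expand: "trace_on V (\<lambda>x. h (k x)) =
      (\<Sum>b\<in>B. \<Sum>c\<in>B. representation B (k b) c * representation B (h c) b)"
    if h: "linear_endo V h" and k: "linear_endo V k" for h k
    unfolding tr
  proof (intro sum.cong refl)
    fix b assume "b \<in> B"
    then have kb: "k b \<in> span B" using BV k B(3) linear_endo_mem by blast
    have hc: "h c \<in> span B" if "c \<in> B" for c using that BV h B(3) linear_endo_mem by blast
    have "k b = (\<Sum>c\<in>B. representation B (k b) c *s c)"
      using sum_representation_eq[OF B(2) kb B(1)] by simp
    then have "h (k b) = (\<Sum>c\<in>B. representation B (k b) c *s h c)"
      using linear_endo_sum[OF h V B(1) BV, of "\<lambda>c. c" "representation B (k b)"] by simp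
    then have "representation B (h (k b)) =
        (\<lambda>d. \<Sum>c\<in>B. representation B (representation B (k b) c *s h c) d)"
      using representation_sum[OF B(2), of B "\<lambda>c. representation B (k b) c *s h c"] hc
      by (simp add: span_scale fun_eq_iff)
    then show "representation B (h (k b)) b =
        (\<Sum>c\<in>B. representation B (k b) c * representation B (h c) b)"
      using hc by (simp add: representation_scale[OF B(2)])
  qed
  show ?thesis
    unfolding expand[OF assms(3,4)] expand[OF assms(4,3)]
    by (subst sum.swap) (simp add: mult.commute)
qed

text \<open>A linear left inverse on \<open>W\<close> of the identity, with range in
  \<open>W\<close>, is a projection onto \<open>W\<close> defined on the whole ambient
  space.\<close>

lemma projection_exists:
  assumes "subspace W"
  obtains p where "Vector_Spaces.linear scale scale p" "range p \<subseteq> W" "\<And>x. x \<in> W \<Longrightarrow> p x = x"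
proof -
  interpret vector_space_pair scale scale ..
  show thesis
    using linear_exists_left_inverse_on[OF linear_id assms] that by auto
qed

text \<open>For a projection \<open>p\<close> onto \<open>W\<close>, \<open>f\<close> equals
  \<open>p \<circ> f\<close> on \<open>V\<close>. Its trace is therefore that of
  \<open>f \<circ> p\<close>, which is zero on \<open>V\<close> because \<open>f\<close> kills
  \<open>W\<close>.\<close>

lemma trace_on_square_zero:
  assumes "finite S" "span S = V" "linear_endo V f"
    and W: "subspace W" "W \<subseteq> V"
    and "\<And>x. x \<in> V \<Longrightarrow> f x \<in> W" "\<And>x. x \<in> W \<Longrightarrow> f x = 0"
  shows "trace_on V f = 0"
proof -
  obtain p where p: "Vector_Spaces.linear scale scale p" "range p \<subseteq> W" "\<And>x. x \<in> W \<Longrightarrow> p x = x"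
    using projection_exists[OF W(1)] by metis
  interpret p: Vector_Spaces.linear scale scale p by (rule p(1))
  have "linear_endo V p"
    using p(2) W(2) by (auto simp: linear_endo_def p.add p.scale)
  have "trace_on V f = trace_on V (\<lambda>x. p (f x))"
    using assms(6) p(3) by (intro trace_on_cong[OF assms(1,2)]) simp
  also have "\<dots> = trace_on V (\<lambda>x. f (p x))"
    by (rule trace_on_commute[OF assms(1,2)]) fact+
  \<comment> \<open>The zero map is written as a multiple of \<open>f\<close> so that
    \<open>trace_on_scale\<close> evaluates its trace.\<close>
  also have "\<dots> = trace_on V (\<lambda>x. 0 *s f x)"
    using assms(7) p(2) by (intro trace_on_cong[OF assms(1,2)]) auto
  also have "\<dots> = 0"
    using trace_on_scale[OF assms(1-3), of 0] by simp
  finally show ?thesis .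
qed

lemma injective_endo_surj_on:
  assumes "Vector_Spaces.linear scale scale T" "finite B" "independent B"
    and "T ` span B \<subseteq> span B" "\<And>x. x \<in> span B \<Longrightarrow> T x = 0 \<Longrightarrow> x = 0"
  shows "T ` span B = span B"
proof -
  interpret vector_space_pair scale scale ..
  interpret T: Vector_Spaces.linear scale scale T by (rule assms(1))
  have inj: "inj_on T (span B)"
    using linear_inj_on_iff_eq_0[OF assms(1) subspace_span] assms(5) by blast
  have ind: "independent (T ` B)"
    using linear_independent_injective_image[OF assms(1,3) inj] .
  have card: "card (T ` B) = card B"
    by (intro card_image inj_on_subset[OF inj]) (rule span_superset)
  have sub: "T ` B \<subseteq> span B" using assms(4) span_superset by blast
  have "w \<in> span (T ` B)" if w: "w \<in> span B" for w
  proof (rule ccontr)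
    assume nw: "w \<notin> span (T ` B)"
    then have "independent (insert w (T ` B))" using ind by (simp add: independent_insertI)
    then have "card (insert w (T ` B)) \<le> card B"
      using independent_span_bound[OF assms(2)] w sub by blast
    moreover have "w \<notin> T ` B" using nw span_base by blast
    ultimately show False using card assms(2) by simp
  qed
  then show ?thesis using assms(4) T.span_image[of B] by blast
qed

end

section \<open>The Killing form\<close>

context lie_algebra
begin

lemma zero_mem: "0 \<in> L"
  using subspace_carrier subspace_0 by blast

lemma add_mem: "x \<in> L \<Longrightarrow> y \<in> L \<Longrightarrow> x + y \<in> L"
  using subspace_carrier subspace_add by blast

lemma scale_mem: "x \<in> L \<Longrightarrow> scale c x \<in> L"
  using subspace_carrier subspace_scale by blast

lemma br_minus_right: "x \<in> L \<Longrightarrow> y \<in> L \<Longrightarrow> br x (- y) = - br x y"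
  using br_scale_right[of x y "-1"] by simp

lemma br_diff_right: "x \<in> L \<Longrightarrow> y \<in> L \<Longrightarrow> z \<in> L \<Longrightarrow> br x (y - z) = br x y - br x z"
  using br_add_right[of x y "- z"] br_minus_right[of x z] scale_mem[of z "-1"] by simp

lemma br_anticommute:
  assumes "x \<in> L" "y \<in> L" shows "br y x = - br x y"
proof -
  have "br (x + y) (x + y) = br x x + br x y + (br y x + br y y)"
    using assms by (simp add: br_add_left br_add_right add_mem algebra_simps)
  then show ?thesis
    using assms by (simp add: br_alternating add_mem eq_neg_iff_add_eq_0 add.commute)
qed

lemma linear_endo_br: "x \<in> L \<Longrightarrow> linear_endo L (br x)"
  by (simp add: linear_endo_def br_closed br_add_right br_scale_right)

lemma linear_endo_br_br: "x \<in> L \<Longrightarrow> y \<in> L \<Longrightarrow> linear_endo L (\<lambda>z. br x (br y z))"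
  by (simp add: linear_endo_def br_closed br_add_right br_scale_right)

lemma linear_endo_br_br_br:
  "x \<in> L \<Longrightarrow> y \<in> L \<Longrightarrow> w \<in> L \<Longrightarrow> linear_endo L (\<lambda>z. br x (br y (br w z)))"
  by (simp add: linear_endo_def br_closed br_add_right br_scale_right)

text \<open>The Jacobi identity in the form that makes the adjoint representation a
  homomorphism.\<close>

lemma br_br_left:
  assumes "x \<in> L" "y \<in> L" "z \<in> L"
  shows "br (br x y) z = br x (br y z) - br y (br x z)"
proof -
  have "br z (br x y) = - br (br x y) z" "br z x = - br x z"
    using assms br_anticommute br_closed by blast+
  then show ?thesis
    using jacobi[OF assms] assms br_minus_right[of y "br x z"] by (simp add: br_closed)
qed

lemma killing_add_left:
  assumes "x \<in> L" "y \<in> L" "z \<in> L"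
  shows "killing (x + y) z = killing x z + killing y z"
proof -
  obtain S where S: "finite S" "span S = L" using finite_dimensional by blast
  have "killing (x + y) z = trace_on L (\<lambda>w. br x (br z w) + br y (br z w))"
    unfolding killing_def using assms
    by (intro trace_on_cong[OF S]) (simp add: br_add_left br_closed)
  also have "\<dots> = killing x z + killing y z"
    unfolding killing_def using assms
    by (intro trace_on_add[OF S] linear_endo_br_br)
  finally show ?thesis .
qed

lemma killing_scale_left:
  assumes "x \<in> L" "z \<in> L"
  shows "killing (scale c x) z = c * killing x z"
proof -
  obtain S where S: "finite S" "span S = L" using finite_dimensional by blast
  have "killing (scale c x) z = trace_on L (\<lambda>w. scale c (br x (br z w)))"
    unfolding killing_def using assms
    by (intro trace_on_cong[OF S]) (simp add: br_scale_left br_closed)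
  also have "\<dots> = c * killing x z"
    unfolding killing_def using assms
    by (intro trace_on_scale[OF S] linear_endo_br_br)
  finally show ?thesis .
qed

text \<open>Writing \<open>ad x\<close> for \<open>br x\<close>, each side is the trace of
  \<open>ad x \<circ> ad y \<circ> ad z\<close> minus one further trace: that of
  \<open>ad y \<circ> ad x \<circ> ad z\<close> on the left and of
  \<open>ad x \<circ> ad z \<circ> ad y\<close> on the right. These two agree by moving
  \<open>ad y\<close> cyclically.\<close>

lemma killing_invariant:
  assumes "x \<in> L" "y \<in> L" "z \<in> L"
  shows "killing (br x y) z = killing x (br y z)"
proof -
  obtain S where S: "finite S" "span S = L" using finite_dimensional by blast
  have 1: "killing (br x y) z + trace_on L (\<lambda>w. br y (br x (br z w))) =
      trace_on L (\<lambda>w. br x (br y (br z w)))"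
    unfolding killing_def using assms
    by (subst trace_on_add[OF S, symmetric])
      (auto intro!: linear_endo_br_br linear_endo_br_br_br trace_on_cong[OF S] simp: br_closed br_br_left)
  have 2: "killing x (br y z) + trace_on L (\<lambda>w. br x (br z (br y w))) =
      trace_on L (\<lambda>w. br x (br y (br z w)))"
    unfolding killing_def using assms
    by (subst trace_on_add[OF S, symmetric])
      (auto intro!: linear_endo_br_br linear_endo_br_br_br trace_on_cong[OF S]
        simp: br_closed br_br_left br_diff_right)
  have "trace_on L (\<lambda>w. br y (br x (br z w))) = trace_on L (\<lambda>w. br x (br z (br y w)))"
    using trace_on_commute[OF S linear_endo_br linear_endo_br_br] assms by blast
  then show ?thesis using 1 2 by (metis add_right_cancel)
qed

lemma lie_ideal_mem_right: "lie_ideal I \<Longrightarrow> x \<in> L \<Longrightarrow> y \<in> I \<Longrightarrow> br y x \<in> I"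
  using br_anticommute[of x y] subspace_neg[of I "br x y"] by (auto simp: lie_ideal_def)

text \<open>An instance of \<open>trace_on_square_zero\<close> with \<open>W = A\<close>:
  \<open>br a\<close> maps \<open>L\<close> into \<open>A\<close>, while \<open>br x\<close>
  preserves \<open>A\<close> and \<open>br a\<close> then kills it.\<close>

lemma killing_abelian_ideal:
  assumes A: "lie_ideal A" "\<And>a b. a \<in> A \<Longrightarrow> b \<in> A \<Longrightarrow> br a b = 0"
    and "a \<in> A" "x \<in> L"
  shows "killing a x = 0"
proof -
  obtain S where S: "finite S" "span S = L" using finite_dimensional by blast
  have *: "subspace A" "A \<subseteq> L" "\<And>x y. x \<in> L \<Longrightarrow> y \<in> A \<Longrightarrow> br x y \<in> A"
    using A(1) by (auto simp: lie_ideal_def)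
  have "a \<in> L" using assms * by blast
  then show ?thesis
    unfolding killing_def using assms * lie_ideal_mem_right[OF A(1)]
    by (intro trace_on_square_zero[OF S _ *(1,2)] linear_endo_br_br)
      (auto simp: br_closed)
qed

lemma lie_algebra_ideal:
  assumes "lie_ideal I" shows "lie_algebra scale I br"
proof
  have I: "subspace I" "I \<subseteq> L" "\<And>x y. x \<in> L \<Longrightarrow> y \<in> I \<Longrightarrow> br x y \<in> I"
    using assms by (auto simp: lie_ideal_def)
  obtain S where S: "finite S" "span S = L" using finite_dimensional by blast
  show "subspace I" by (rule I(1))
  show "\<exists>B. finite B \<and> span B = I"
    using subspace_finite_basis[OF I(1), of S] S I(2) by metis
  fix x y z c assume "x \<in> I"
  then have x: "x \<in> L" using I by blast
  show "br x x = 0" using x br_alternating by blast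
  assume "y \<in> I"
  then have y: "y \<in> L" using I by blast
  show "br x y \<in> I" using x \<open>y \<in> I\<close> I by blast
  show "br (scale c x) y = scale c (br x y)" "br x (scale c y) = scale c (br x y)"
    using x y br_scale_left br_scale_right by blast+
  assume "z \<in> I"
  then have z: "z \<in> L" using I by blast
  show "br (x + y) z = br x z + br y z" "br x (y + z) = br x y + br x z"
    "br x (br y z) + br y (br z x) + br z (br x y) = 0"
    using x y z br_add_left br_add_right jacobi by blast+
qed

end

section \<open>Orthogonal complements of ideals\<close>

context self_dual_lie_algebra
begin

definition orthogonal :: "'v set \<Rightarrow> 'v set" where
  "orthogonal I = {v\<in>L. \<forall>w\<in>I. \<Omega> v w = 0}"

lemma form_zero_left: "y \<in> L \<Longrightarrow> \<Omega> 0 y = 0"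
  using form_scale[of y y 0] by simp

lemma form_add_right: "x \<in> L \<Longrightarrow> y \<in> L \<Longrightarrow> z \<in> L \<Longrightarrow> \<Omega> x (y + z) = \<Omega> x y + \<Omega> x z"
  using form_add[of y z x] form_sym[of x y] form_sym[of x z] form_sym[of x "y + z"] add_mem
  by simp

lemma form_scale_right: "x \<in> L \<Longrightarrow> y \<in> L \<Longrightarrow> \<Omega> x (scale c y) = c * \<Omega> x y"
  using form_scale[of y x c] form_sym[of x y] form_sym[of x "scale c y"] scale_mem by simp

lemma form_eq_zeroD: "x \<in> L \<Longrightarrow> (\<And>y. y \<in> L \<Longrightarrow> \<Omega> x y = 0) \<Longrightarrow> x = 0"
  using form_nondegenerate by (auto simp: form_radical_def)

text \<open>Symmetry and invariance move the bracket to the other argument: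
  \<open>\<Omega> (br x y) w\<close> becomes \<open>\<Omega> y (br w x)\<close>, and
  \<open>br w x\<close> lies in \<open>I\<close>.\<close>

lemma lie_ideal_orthogonal:
  assumes "lie_ideal I" shows "lie_ideal (orthogonal I)"
proof -
  have I: "I \<subseteq> L" "\<And>x y. x \<in> L \<Longrightarrow> y \<in> I \<Longrightarrow> br x y \<in> I"
    using assms by (auto simp: lie_ideal_def)
  have "br x y \<in> orthogonal I" if "x \<in> L" "y \<in> orthogonal I" for x y
  proof -
    have y: "y \<in> L" using that by (simp add: orthogonal_def)
    have "\<Omega> (br x y) w = 0" if "w \<in> I" for w
    proof -
      have w: "w \<in> L" using that I by blast
      have "\<Omega> (br x y) w = \<Omega> w (br x y)" using form_sym \<open>x \<in> L\<close> y w br_closed by blast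
      also have "\<dots> = \<Omega> (br w x) y" using form_invariant \<open>x \<in> L\<close> y w by simp
      also have "\<dots> = \<Omega> y (br w x)" using form_sym \<open>x \<in> L\<close> y w br_closed by blast
      also have "\<dots> = 0"
        using \<open>y \<in> orthogonal I\<close> lie_ideal_mem_right[OF assms \<open>x \<in> L\<close> that]
        by (simp add: orthogonal_def)
      finally show ?thesis .
    qed
    then show ?thesis using \<open>x \<in> L\<close> y by (simp add: orthogonal_def br_closed)
  qed
  moreover have "subspace (orthogonal I)"
    using I(1)
    by (auto intro!: subspaceI simp: orthogonal_def zero_mem add_mem scale_mem form_zero_left
        form_add form_scale subset_iff)
  ultimately show ?thesis by (auto simp: lie_ideal_def orthogonal_def)
qed

text \<open>The restriction of \<open>\<Omega>\<close> to \<open>I\<close> is nondegenerate, so the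
  functional \<open>\<Omega> v\<close> on \<open>I\<close> is also given by some \<open>x\<close> in
  \<open>I\<close>. The difference of \<open>v\<close> and \<open>x\<close> is then orthogonal to
  \<open>I\<close>.\<close>

lemma orthogonal_decomposition:
  assumes I: "subspace I" "I \<subseteq> L" "I \<inter> orthogonal I = {0}" and v: "v \<in> L"
  obtains x y where "x \<in> I" "y \<in> orthogonal I" "v = x + y"
proof -
  obtain S where "finite S" "span S = L" using finite_dimensional by blast
  then obtain B where B: "finite B" "independent B" "span B = I"
    using subspace_finite_basis[OF I(1), of S] I(2) by metis
  have BI: "b \<in> I" "b \<in> L" if "b \<in> B" for b using that B(3) I(2) span_base by auto
  obtain p where p: "Vector_Spaces.linear scale scale p" "range p \<subseteq> I" "\<And>x. x \<in> I \<Longrightarrow> p x = x"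
    using projection_exists[OF I(1)] by metis
  interpret p: Vector_Spaces.linear scale scale p by (rule p(1))
  have pL: "p u \<in> L" for u using p(2) I(2) by blast
  \<comment> \<open>the Gram operator of \<open>\<Omega>\<close> on \<open>I\<close> in the basis \<open>B\<close>; the projection makes it linear everywhere\<close>
  define T where "T u = (\<Sum>b\<in>B. scale (\<Omega> (p u) b) b)" for u
  have T_lin: "Vector_Spaces.linear scale scale T"
  proof
    fix c x y
    show "T (x + y) = T x + T y"
      unfolding T_def using BI pL
      by (simp add: p.add form_add scale_left_distrib sum.distrib)
    show "T (scale c x) = scale c (T x)"
      unfolding T_def using BI pL
      by (simp add: p.scale form_scale scale_sum_right)
  qed
  have orth: "w \<in> orthogonal I" if w: "w \<in> L" "\<And>b. b \<in> B \<Longrightarrow> \<Omega> w b = 0" for w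
  proof -
    have "\<Omega> w u = 0" if "u \<in> span B" for u
    proof -
      have "u \<in> L \<and> \<Omega> w u = 0"
        using that
      proof (induction rule: span_induct_alt)
        case base
        show ?case using form_scale_right[OF w(1) w(1), of 0] zero_mem by simp
      next
        case (step c x y)
        then show ?case
          using w BI by (simp add: form_add_right form_scale_right scale_mem add_mem)
      qed
      then show ?thesis by blast
    qed
    then show ?thesis using w(1) B(3) by (simp add: orthogonal_def)
  qed
  have coeffs: "\<forall>b\<in>B. c b = d b"
    if "(\<Sum>b\<in>B. scale (c b) b) = (\<Sum>b\<in>B. scale (d b) b)" for c d
  proof -
    have "(\<Sum>b\<in>B. scale (c b - d b) b) = 0"
      using that by (simp add: scale_left_diff_distrib sum_subtractf)
    then show ?thesis using B(1,2) independentD[of B B "\<lambda>b. c b - d b"] by auto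
  qed
  have comb: "(\<Sum>b\<in>B. scale (c b) b) \<in> span B" for c
    by (intro span_sum span_scale span_base)
  \<comment> \<open>The kernel of \<open>T\<close> on \<open>I\<close> is
    \<open>I \<inter> orthogonal I\<close>, which is trivial.\<close>
  have "T ` span B = span B"
  proof (rule injective_endo_surj_on[OF T_lin B(1,2)])
    show "T ` span B \<subseteq> span B"
      using comb by (auto simp: T_def)
    fix x assume x: "x \<in> span B" "T x = 0"
    then have "\<forall>b\<in>B. \<Omega> x b = 0"
      using coeffs[of "\<Omega> (p x)" "\<lambda>_. 0"] p(3) B(3) by (auto simp: T_def)
    then have "x \<in> orthogonal I" using orth x(1) B(3) I(2) by blast
    then show "x = 0" using x(1) B(3) I(3) by blast
  qed
  \<comment> \<open>The prescribed coefficients make \<open>x\<close> pair with each basis vector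
    exactly as \<open>v\<close> does.\<close>
  then obtain x where x: "x \<in> I" "T x = (\<Sum>b\<in>B. scale (\<Omega> v b) b)"
    using comb[of "\<Omega> v"] B(3) by (metis imageE)
  then have eq: "\<forall>b\<in>B. \<Omega> x b = \<Omega> v b"
    using coeffs[of "\<Omega> (p x)" "\<Omega> v"] p(3) by (auto simp: T_def)
  \<comment> \<open>The negative of \<open>x\<close> is written as a scalar multiple so that
    \<open>scale_mem\<close> and \<open>form_scale\<close> apply to it.\<close>
  have xL: "x \<in> L" "scale (-1) x \<in> L" using x I(2) scale_mem by blast+
  have "v + scale (-1) x \<in> orthogonal I"
  proof (rule orth)
    show "v + scale (-1) x \<in> L" using v xL add_mem by blast
    fix b assume "b \<in> B"
    then show "\<Omega> (v + scale (-1) x) b = 0"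
      using eq BI v xL form_add[of v "scale (-1) x" b] form_scale[of x b "-1"] by simp
  qed
  then show thesis using that[of x "v + scale (-1) x"] x(1) by simp
qed

text \<open>The factors are \<open>I\<close> and its orthogonal complement with the restricted
  bracket and form. Addition is a bijection from their product to \<open>L\<close>, and its inverse
  is the required isometry.\<close>

lemma decomposable_orthogonal:
  assumes ideal: "lie_ideal I" and int: "I \<inter> orthogonal I = {0}"
    and nz: "I \<noteq> {0}" "I \<noteq> L"
  shows "decomposable scale L br \<Omega>"
proof -
  define J where "J = orthogonal I"
  have idealJ: "lie_ideal J" using lie_ideal_orthogonal[OF ideal] by (simp add: J_def)
  have I: "subspace I" "I \<subseteq> L" "\<And>x y. x \<in> L \<Longrightarrow> y \<in> I \<Longrightarrow> br x y \<in> I"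
    using ideal by (auto simp: lie_ideal_def)
  have J: "subspace J" "J \<subseteq> L" "\<And>x y. x \<in> L \<Longrightarrow> y \<in> J \<Longrightarrow> br x y \<in> J"
    using idealJ by (auto simp: lie_ideal_def)
  have IJ: "I \<inter> J = {0}" using int by (simp add: J_def)
  have decomp: "\<exists>x y. x \<in> I \<and> y \<in> J \<and> v = x + y" if "v \<in> L" for v
    using orthogonal_decomposition[OF I(1,2) int that] unfolding J_def by metis
  have orth: "\<Omega> x y = 0" "\<Omega> y x = 0" if "x \<in> I" "y \<in> J" for x y
    using that I(2) form_sym[of x y] by (auto simp: J_def orthogonal_def)
  \<comment> \<open>Both factors are ideals, so a mixed bracket lies in their intersection.\<close>
  have comm: "br x y = 0" "br y x = 0" if "x \<in> I" "y \<in> J" for x y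
    using that IJ I J lie_ideal_mem_right[OF ideal, of y x] lie_ideal_mem_right[OF idealJ, of x y]
    by blast+
  have radI: "x = 0" if "x \<in> I" "\<And>y. y \<in> I \<Longrightarrow> \<Omega> x y = 0" for x
    using that I(2) int by (auto simp: orthogonal_def)
  \<comment> \<open>Elements of \<open>J\<close> are already orthogonal to \<open>I\<close>. One
    that is also orthogonal to \<open>J\<close> is orthogonal to \<open>I + J = L\<close>.\<close>
  have radJ: "x = 0" if x: "x \<in> J" "\<And>y. y \<in> J \<Longrightarrow> \<Omega> x y = 0" for x
  proof (rule form_eq_zeroD)
    show "x \<in> L" using x J by blast
    fix y assume "y \<in> L"
    then obtain y1 y2 where y: "y1 \<in> I" "y2 \<in> J" "y = y1 + y2" using decomp by blast
    moreover have "x \<in> L" "y1 \<in> L" "y2 \<in> L" using x y I J by blast+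
    ultimately show "\<Omega> x y = 0"
      using x orth(2)[of y1 x] form_add_right[of x y1 y2] by simp
  qed
  have sub: "self_dual_lie_algebra scale K br \<Omega>"
    if K: "lie_ideal K" and rad: "\<And>x. x \<in> K \<Longrightarrow> (\<And>y. y \<in> K \<Longrightarrow> \<Omega> x y = 0) \<Longrightarrow> x = 0" for K
  proof -
    interpret K: lie_algebra scale K br by (rule lie_algebra_ideal[OF K])
    have KL: "\<And>x. x \<in> K \<Longrightarrow> x \<in> L" using K by (auto simp: lie_ideal_def)
    show ?thesis
    proof
      show "form_radical K \<Omega> = {0}"
        using rad K.zero_mem form_zero_left KL by (auto simp: form_radical_def)
    qed (simp_all add: KL form_add form_scale form_sym form_invariant)
  qed
  have "J \<noteq> {0}"
  proof
    assume "J = {0}"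
    then have "L \<subseteq> I" using decomp by fastforce
    then show False using I(2) nz(2) by blast
  qed
  \<comment> \<open>\<open>\<phi>\<close> sends a vector to its pair of components in
    \<open>I\<close> and \<open>J\<close>.\<close>
  define \<phi> where "\<phi> = inv_into (I \<times> J) (\<lambda>(x, y). x + y)"
  have bij: "bij_betw (\<lambda>(x, y). x + y) (I \<times> J) L"
  proof (rule bij_betw_imageI)
    show "inj_on (\<lambda>(x, y). x + y) (I \<times> J)"
    proof (rule inj_onI, clarify)
      fix x y x' y' assume *: "x \<in> I" "y \<in> J" "x' \<in> I" "y' \<in> J" "x + y = x' + y'"
      then have eq: "x - x' = y' - y" by (simp add: algebra_simps)
      have "x - x' \<in> I" "y' - y \<in> J" using * I J subspace_diff by blast+
      then have "y' - y \<in> I \<inter> J" using eq by simp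
      then have "y' - y = 0" using IJ by blast
      then show "x = x' \<and> y = y'" using eq by simp
    qed
    show "(\<lambda>(x, y). x + y) ` (I \<times> J) = L"
    proof
      show "(\<lambda>(x, y). x + y) ` (I \<times> J) \<subseteq> L" using add_mem I(2) J(2) by auto
      show "L \<subseteq> (\<lambda>(x, y). x + y) ` (I \<times> J)"
      proof
        fix v assume "v \<in> L"
        then obtain x y where "x \<in> I" "y \<in> J" "v = x + y" using decomp by blast
        then show "v \<in> (\<lambda>(x, y). x + y) ` (I \<times> J)" by (intro image_eqI[of _ _ "(x, y)"]) auto
      qed
    qed
  qed
  have \<phi>: "\<phi> (x + y) = (x, y)" if "x \<in> I" "y \<in> J" for x y
    using inv_into_f_f[OF bij_betw_imp_inj_on[OF bij], of "(x, y)"] that by (simp add: \<phi>_def)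
  \<comment> \<open>This fact discharges the locale premise of the equation defining scalar
    multiplication on pairs.\<close>
  have "module_prod scale scale" ..
  have "isometric_lie_iso scale L br \<Omega> (module_prod.scale scale scale) (I \<times> J)
      (product_bracket br br) (orthogonal_sum_form \<Omega> \<Omega>) \<phi>"
    unfolding isometric_lie_iso_def
  proof (intro conjI ballI allI)
    show "bij_betw \<phi> L (I \<times> J)" unfolding \<phi>_def by (rule bij_betw_inv_into[OF bij])
    fix v assume "v \<in> L"
    then obtain v1 v2 where v: "v1 \<in> I" "v2 \<in> J" "v = v1 + v2" using decomp by blast
    then have vL: "v1 \<in> L" "v2 \<in> L" using I J by auto
    show "\<phi> (scale c v) = module_prod.scale scale scale c (\<phi> v)" for c
      using v \<phi>[of "scale c v1" "scale c v2"] subspace_scale[OF I(1)] subspace_scale[OF J(1)]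
      by (simp add: \<phi> module_prod.scale_def[OF \<open>module_prod scale scale\<close>] scale_right_distrib)
    fix w assume "w \<in> L"
    then obtain w1 w2 where w: "w1 \<in> I" "w2 \<in> J" "w = w1 + w2" using decomp by blast
    then have wL: "w1 \<in> L" "w2 \<in> L" using I J by auto
    have "v + w = (v1 + w1) + (v2 + w2)" using v w by (simp add: algebra_simps)
    moreover have "v1 + w1 \<in> I" "v2 + w2 \<in> J"
      using v w subspace_add[OF I(1)] subspace_add[OF J(1)] by blast+
    ultimately have "\<phi> (v + w) = (v1 + w1, v2 + w2)" using \<phi> by metis
    then show "\<phi> (v + w) = \<phi> v + \<phi> w" using v w \<phi> by simp
    have "br v w = br v1 w1 + br v2 w2"
      using v w vL wL comm by (simp add: br_add_left br_add_right add_mem)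
    then show "\<phi> (br v w) = product_bracket br br (\<phi> v) (\<phi> w)"
      using v w vL \<phi> I(3) J(3) by (simp add: product_bracket_def)
    show "orthogonal_sum_form \<Omega> \<Omega> (\<phi> v) (\<phi> w) = \<Omega> v w"
      using v w vL wL orth
      by (simp add: \<phi> orthogonal_sum_form_def form_add form_add_right add_mem)
  qed
  moreover have "self_dual_lie_algebra scale I br \<Omega>" "self_dual_lie_algebra scale J br \<Omega>"
    using sub ideal idealJ radI radJ by blast+
  ultimately show ?thesis
    unfolding decomposable_def using nz(1) \<open>J \<noteq> {0}\<close> by blast
qed

section \<open>Ideals on which the form is a multiple of the Killing form\<close>

text \<open>Once \<open>I \<inter> orthogonal I\<close> is shown to vanish, a proper nonzero
  \<open>I\<close> would split \<open>L\<close>. The hypothesis passes to smaller ideals, which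
  allows its use on the intersection.\<close>

lemma ideal_form_eq_killing_trivial:
  assumes indec: "indecomposable scale L br \<Omega>" and ideal: "lie_ideal I"
    and eq: "\<And>x y. x \<in> I \<Longrightarrow> y \<in> L \<Longrightarrow> \<Omega> x y = t * killing x y"
  shows "I = {0} \<or> I = L"
proof -
  let ?A = "I \<inter> orthogonal I"
  have AL: "\<And>x. x \<in> ?A \<Longrightarrow> x \<in> L" by (auto simp: orthogonal_def)
  have A: "lie_ideal ?A"
    using ideal lie_ideal_orthogonal[OF ideal] subspace_inter by (auto simp: lie_ideal_def)
  \<comment> \<open>Invariance gives \<open>\<Omega> (br a b) y = \<Omega> a (br b y)\<close>, where
    \<open>a\<close> is orthogonal to \<open>I\<close> and \<open>br b y\<close> lies in
    \<open>I\<close>.\<close>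
  have ab: "br a b = 0" if a: "a \<in> ?A" and b: "b \<in> ?A" for a b
  proof (rule form_eq_zeroD)
    have L: "a \<in> L" "b \<in> L" using a b AL by blast+
    show "br a b \<in> L" using L br_closed by blast
    fix y assume "y \<in> L"
    moreover from this have "br b y \<in> I" using lie_ideal_mem_right[OF ideal] b by blast
    ultimately show "\<Omega> (br a b) y = 0" using form_invariant L a by (simp add: orthogonal_def)
  qed
  have "?A \<subseteq> {0}"
  proof
    fix a assume a: "a \<in> ?A"
    then have "a = 0"
      using eq killing_abelian_ideal[OF A ab a] AL by (intro form_eq_zeroD) auto
    then show "a \<in> {0}" by simp
  qed
  moreover have "0 \<in> ?A" using A subspace_0 by (auto simp: lie_ideal_def)
  ultimately have "?A = {0}" by blast
  then show ?thesis
    using decomposable_orthogonal[OF ideal] indec by (auto simp: indecomposable_def)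
qed

text \<open>\<open>\<Omega>\<close> and the Killing form are both bilinear enough and invariant,
  hence so is the combination, and the radical of an invariant form absorbs brackets.\<close>

lemma lie_ideal_radical:
  "lie_ideal (form_radical L (\<lambda>x y. \<Omega> x y - t * killing x y))" (is "lie_ideal ?R")
proof -
  have "subspace ?R"
  proof (rule subspaceI)
    show "0 \<in> ?R"
      using killing_scale_left[OF zero_mem, of _ 0] zero_mem
      by (simp add: form_radical_def form_zero_left)
  qed (auto simp: form_radical_def add_mem scale_mem form_add form_scale killing_add_left
      killing_scale_left distrib_left mult.left_commute)
  moreover have "br x y \<in> ?R" if "x \<in> L" "y \<in> ?R" for x y
  proof -
    have y: "y \<in> L" using that by (simp add: form_radical_def)
    \<comment> \<open>Invariance handles the bracket with the radical element on the left;
      anticommutativity then gives the order used in \<open>lie_ideal\<close>.\<close>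
    have "br y x \<in> ?R"
      using that by (auto simp: form_radical_def form_invariant killing_invariant br_closed)
    then have "- br y x \<in> ?R" using subspace_neg \<open>subspace ?R\<close> by blast
    then show ?thesis using br_anticommute[OF y that(1)] by simp
  qed
  ultimately show ?thesis by (auto simp: lie_ideal_def form_radical_def)
qed

text \<open>If \<open>L\<close> were abelian, it would be an abelian ideal of itself, so the Killing
  form and with it \<open>\<Omega>\<close> would vanish, against nondegeneracy on a nonzero space.
  For ideals, the hypothesis on \<open>L\<close> restricts to each of them.\<close>

lemma simple_if_form_eq_killing:
  assumes indec: "indecomposable scale L br \<Omega>"
    and eq: "\<And>x y. x \<in> L \<Longrightarrow> y \<in> L \<Longrightarrow> \<Omega> x y = t * killing x y"
  shows "simple"
proof -
  have "\<not> abelian"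
  proof
    assume "abelian"
    then have "br x y = 0" if "x \<in> L" "y \<in> L" for x y using that by (simp add: abelian_def)
    moreover have "lie_ideal L" by (simp add: lie_ideal_def subspace_carrier br_closed)
    ultimately have "\<Omega> x y = 0" if "x \<in> L" "y \<in> L" for x y
      using that eq killing_abelian_ideal[of L x y] by simp
    then have "L = {0}" using form_eq_zeroD zero_mem by blast
    then show False using indec by (simp add: indecomposable_def)
  qed
  moreover have "I = {0} \<or> I = L" if "lie_ideal I" for I
  proof (rule ideal_form_eq_killing_trivial[OF indec that])
    show "\<Omega> x y = t * killing x y" if "x \<in> I" "y \<in> L" for x y
      using that eq \<open>lie_ideal I\<close> by (auto simp: lie_ideal_def)
  qed
  ultimately show ?thesis by (simp add: simple_def)
qed

end

theorem theorem6p1: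
  fixes scale :: "'k::real_or_complex \<Rightarrow> 'v::ab_group_add \<Rightarrow> 'v"
    and D :: "'v set" and br :: "'v \<Rightarrow> 'v \<Rightarrow> 'v" and \<Omega> :: "'v \<Rightarrow> 'v \<Rightarrow> 'k" and t :: 'k
  defines "\<kappa> \<equiv> lie_algebra.killing scale D br"
  defines "g \<equiv> \<lambda>x y. \<Omega> x y - t * \<kappa> x y"
  assumes "self_dual_lie_algebra scale D br \<Omega>"
    and "indecomposable scale D br \<Omega>"
  shows "if lie_algebra.simple scale D br \<and> (\<forall>x\<in>D. \<forall>y\<in>D. \<Omega> x y = t * \<kappa> x y)
         then (\<forall>x\<in>D. \<forall>y\<in>D. g x y = 0) \<and> form_radical D g = D
         else form_radical D g = {0}"
proof -
  interpret self_dual_lie_algebra scale D br \<Omega> by fact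
  have ideal: "lie_ideal (form_radical D g)"
    unfolding g_def \<kappa>_def by (rule lie_ideal_radical)
  have "form_radical D g = {0} \<or> form_radical D g = D"
    by (rule ideal_form_eq_killing_trivial[OF assms(4) ideal, of t])
      (auto simp: form_radical_def g_def \<kappa>_def)
  \<comment> \<open>Read contrapositively: when the condition of the \<open>if\<close> fails, the
    radical is not \<open>D\<close>, and the dichotomy leaves only \<open>{0}\<close>.\<close>
  moreover have "simple \<and> (\<forall>x\<in>D. \<forall>y\<in>D. \<Omega> x y = t * \<kappa> x y)" if "form_radical D g = D"
  proof -
    have eq: "\<Omega> x y = t * \<kappa> x y" if "x \<in> D" "y \<in> D" for x y
      using that \<open>form_radical D g = D\<close> by (auto simp: form_radical_def g_def)
    then show ?thesis using simple_if_form_eq_killing[OF assms(4)] by (auto simp: \<kappa>_def)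
  qed
  moreover have "form_radical D g = D" "\<forall>x\<in>D. \<forall>y\<in>D. g x y = 0"
    if "\<forall>x\<in>D. \<forall>y\<in>D. \<Omega> x y = t * \<kappa> x y"
    using that by (auto simp: form_radical_def g_def)
  ultimately show ?thesis by presburger
qed

end
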